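(* ($\alpha$-bound) Let $\mathcal I=(1,m,n,\mathcal X,\mathcal X^{(S)},R)$ be an instance of the ICCSI problem over $\mathbb F_q$ (with $t=1$) and let $\delta\ge0$ be an integer. Then $$N(\alpha(\mathcal I),2\delta+1)\le\mathcal N(\mathcal I,\delta).$$
   Context: Notation: $q$ is a prime power, $\mathbb F_q$ the field with $q$ elements, $[m]=\{1,\dots,m\}$. For a matrix $A$, $A_i$ is its $i$-th row and $\langle A\rangle$ its row space. $w$ is the Hamming weight (number of nonzero entries) of a vector. Instance (with $t=1$): positive integers $m,n$; subspaces $\mathcal X^{(S)}$ and $\mathcal X^{(i)}$ ($i\in[m]$) of $\mathbb F_q^n$ of dimensions $d_S$ and $d_i$; $\mathcal X=\{A\in\mathbb F_q^{m\times n}:A_i\in\mathcal X^{(i)}\}$; a matrix $R\in\mathbb F_q^{m\times n}$ with rows $R_i\in\mathcal X^{(S)}\setminus\mathcal X^{(i)}$. Fix $V^{(S)}\in\mathbb F_q^{d_S\times n}$, $V^{(i)}\in\mathbb F_q^{d_i\times n}$ with $\langle V^{(S)}\rangle=\mathcal X^{(S)}$, $\langle V^{(i)}\rangle=\mathcal X^{(i)}$. Set $\mathcal Z^{(i)}=\{Z\in\mathbb F_q^n:V^{(i)}Z=0,\ R_iZ\ne0\}$. Error-correcting index codes: $L\in\mathbb F_q^{N\times d_S}$ ($N$ a positive integer) represents an $\mathbb F_q$-linear $(\mathcal I,\delta)$-ECIC of length $N$ if for each $i\in[m]$ there is a map $D_i:\mathbb F_q^N\times\mathbb F_q^{d_i}\to\mathbb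 F_q$ with $D_i(LV^{(S)}X+W,V^{(i)}X)=R_iX$ for all $X\in\mathbb F_q^n$ and all $W\in\mathbb F_q^N$ with $w(W)\le\delta$. $\mathcal N(\mathcal I,\delta)$ is the minimum length $N$ of an $\mathbb F_q$-linear $(\mathcal I,\delta)$-ECIC. $N(k,d)$ is the minimum $\ell$ such that there is a $k$-dimensional $\mathbb F_q$-linear code in $\mathbb F_q^\ell$ of minimum Hamming distance $d$. $\alpha(\mathcal I)$ is the maximum dimension of a subspace $U$ of $\mathbb F_q^n$ with $U\setminus\{0\}\subset\bigcup_{i\in[m]}\mathcal Z^{(i)}$. *)

theory Defs
  imports "Jordan_Normal_Form.VS_Connect"
begin

text \<open>
  The field is a type of sort field and finite, so q is its cardinality; vectors and matrices
  are the dimension-carrying ones of the matrix library, since the lengths of codes and the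
  dimensions of the subspaces vary. The index set of the receivers is written as \<open>{..<m}\<close>.
\<close>

abbreviation vec_subspace :: "nat \<Rightarrow> 'a::field vec set \<Rightarrow> bool" where
  "vec_subspace n W \<equiv> VectorSpace.subspace class_ring W (module_vec TYPE('a) n)"

abbreviation vec_subspace_dim :: "nat \<Rightarrow> 'a::field vec set \<Rightarrow> nat" where
  "vec_subspace_dim n W \<equiv>
     vectorspace.dim class_ring ((module_vec TYPE('a) n)\<lparr>carrier := W\<rparr>)"

definition hamming_weight :: "'a::zero vec \<Rightarrow> nat" where
  "hamming_weight v = card {j. j < dim_vec v \<and> v $ j \<noteq> 0}"

definition hamming_dist :: "'a vec \<Rightarrow> 'a vec \<Rightarrow> nat" where
  "hamming_dist x y = card {j. j < dim_vec x \<and> x $ j \<noteq> y $ j}"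

text \<open>Only meaningful for codes with at least two words.\<close>

definition min_dist :: "'a vec set \<Rightarrow> nat" where
  "min_dist C = Min {hamming_dist x y |x y. x \<in> C \<and> y \<in> C \<and> x \<noteq> y}"

text \<open>
  \<open>N(k, d)\<close> over the field \<open>'a\<close>. A code with \<open>k \<ge> 1\<close> and \<open>d \<ge> 1\<close> always exists
  (for example with \<open>l = k * d\<close>), so the least element is a genuine minimum there.
\<close>

definition min_code_length :: "'a::{field,finite} itself \<Rightarrow> nat \<Rightarrow> nat \<Rightarrow> nat" where
  "min_code_length F k d =
     (LEAST l. \<exists>C :: 'a vec set. vec_subspace l C \<and> vec_subspace_dim l C = k \<and> min_dist C = d)"

definition iccsi_instance ::
  "nat \<Rightarrow> nat \<Rightarrow> (nat \<Rightarrow> 'a::{field,finite} vec set) \<Rightarrow> 'a vec set \<Rightarrow> 'a mat \<Rightarrow> bool" where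
  "iccsi_instance m n X XS R \<longleftrightarrow>
     0 < m \<and> 0 < n \<and> vec_subspace n XS \<and> (\<forall>i<m. vec_subspace n (X i)) \<and>
     R \<in> carrier_mat m n \<and> (\<forall>i<m. row R i \<in> XS - X i)"

definition generator_matrix :: "nat \<Rightarrow> 'a::field vec set \<Rightarrow> 'a mat \<Rightarrow> bool" where
  "generator_matrix n W V \<longleftrightarrow>
     V \<in> carrier_mat (vec_subspace_dim n W) n \<and> vec_space.row_space n V = W"

definition confusion_set :: "nat \<Rightarrow> 'a::field mat \<Rightarrow> 'a vec \<Rightarrow> 'a vec set" where
  "confusion_set n V r =
     {Z \<in> carrier_vec n. V *\<^sub>v Z = 0\<^sub>v (dim_row V) \<and> r \<bullet> Z \<noteq> 0}"

definition iccsi_alpha ::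
  "nat \<Rightarrow> nat \<Rightarrow> (nat \<Rightarrow> 'a::{field,finite} mat) \<Rightarrow> 'a mat \<Rightarrow> nat" where
  "iccsi_alpha m n V R =
     Max {vec_subspace_dim n U |U. vec_subspace n U \<and>
            U - {0\<^sub>v n} \<subseteq> (\<Union>i<m. confusion_set n (V i) (row R i))}"

definition represents_ecic ::
  "nat \<Rightarrow> nat \<Rightarrow> 'a::{field,finite} mat \<Rightarrow> (nat \<Rightarrow> 'a mat) \<Rightarrow> 'a mat \<Rightarrow> nat \<Rightarrow>
     nat \<Rightarrow> 'a mat \<Rightarrow> bool" where
  "represents_ecic m n VS V R \<delta> N L \<longleftrightarrow>
     0 < N \<and> L \<in> carrier_mat N (dim_row VS) \<and>
     (\<forall>i<m. \<exists>D :: 'a vec \<Rightarrow> 'a vec \<Rightarrow> 'a.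
        \<forall>X \<in> carrier_vec n. \<forall>W \<in> carrier_vec N. hamming_weight W \<le> \<delta> \<longrightarrow>
          D (L *\<^sub>v (VS *\<^sub>v X) + W) (V i *\<^sub>v X) = row R i \<bullet> X)"

text \<open>
  Whenever every row of \<open>R\<close> lies in the row space of \<open>VS\<close>, the \<open>(2 * \<delta> + 1)\<close>-fold repetition
  of \<open>VS *\<^sub>v X\<close> is such a code, so the least element is a genuine minimum.
\<close>

definition min_ecic_length ::
  "nat \<Rightarrow> nat \<Rightarrow> 'a::{field,finite} mat \<Rightarrow> (nat \<Rightarrow> 'a mat) \<Rightarrow> 'a mat \<Rightarrow> nat \<Rightarrow> nat" where
  "min_ecic_length m n VS V R \<delta> = (LEAST N. \<exists>L. represents_ecic m n VS V R \<delta> N L)"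

end

theory Submission
  imports Defs
begin

text \<open>
  A matrix \<open>L\<close> represents an ECIC iff the weight of \<open>L VS Z\<close> exceeds \<open>2 \<delta>\<close> for every \<open>Z\<close> that
  some receiver must resolve, i.e. for every \<open>Z\<close> in a confusion set. On a subspace \<open>U\<close> that is
  covered by the confusion sets apart from 0, the map \<open>L VS\<close> is therefore injective, and its image
  is a code of length \<open>N\<close>, dimension \<open>dim U\<close> and minimum distance at least \<open>2 \<delta> + 1\<close>.
  Taking \<open>U\<close> of maximal dimension and \<open>N\<close> minimal gives the bound.
\<close>

section \<open>Subspaces of coordinate spaces over a finite field\<close>

lemma finite_carrier_vec: "finite (carrier_vec n :: 'a::finite vec set)"
proof -
  have "carrier_vec n \<subseteq> vec_of_list ` {xs :: 'a list. set xs \<subseteq> UNIV \<and> length xs = n}"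
  proof
    fix v :: "'a vec"
    assume "v \<in> carrier_vec n"
    then have "v = vec_of_list (list_of_vec v)" "length (list_of_vec v) = n"
      by (auto simp: vec_list)
    then show "v \<in> vec_of_list ` {xs. set xs \<subseteq> UNIV \<and> length xs = n}" by blast
  qed
  then show ?thesis by (rule finite_subset) (intro finite_imageI finite_lists_length_eq finite_UNIV)
qed

lemma vec_subspace_iff:
  fixes W :: "'a::field vec set"
  shows "vec_subspace n W \<longleftrightarrow> W \<subseteq> carrier_vec n \<and> 0\<^sub>v n \<in> W \<and>
    (\<forall>v\<in>W. \<forall>w\<in>W. v + w \<in> W) \<and> (\<forall>c. \<forall>v\<in>W. c \<cdot>\<^sub>v v \<in> W)"
  using vec_vs[of n, where ?'a='a] vec_module[of n, where ?'a='a]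
  unfolding VectorSpace.subspace_def submodule_def
  by (auto simp: module_vec_simps)

lemma vec_subspace_vectorspace:
  fixes W :: "'a::field vec set"
  assumes "vec_subspace n W"
  shows "vectorspace class_ring ((module_vec TYPE('a) n)\<lparr>carrier := W\<rparr>)"
  using vectorspace.subspace_is_vs[OF vec_vs assms] .

lemma vec_subspace_fin_dim:
  fixes W :: "'a::{field,finite} vec set"
  assumes "vec_subspace n W"
  shows "vectorspace.fin_dim class_ring ((module_vec TYPE('a) n)\<lparr>carrier := W\<rparr>)"
proof -
  interpret W: vectorspace class_ring "(module_vec TYPE('a) n)\<lparr>carrier := W\<rparr>"
    by (rule vec_subspace_vectorspace[OF assms])
  have "finite W" using assms finite_subset[OF _ finite_carrier_vec] by (auto simp: vec_subspace_iff)
  moreover have "W.span W = W"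
    using W.in_own_span[of W] W.span_is_subset2[of W] by auto
  ultimately show ?thesis unfolding W.fin_dim_def by auto
qed

lemma vec_subspace_dim_eq_0_iff:
  fixes W :: "'a::{field,finite} vec set"
  assumes "vec_subspace n W"
  shows "vec_subspace_dim n W = 0 \<longleftrightarrow> W = {0\<^sub>v n}"
proof -
  interpret W: vectorspace class_ring "(module_vec TYPE('a) n)\<lparr>carrier := W\<rparr>"
    by (rule vec_subspace_vectorspace[OF assms])
  have zero: "\<zero>\<^bsub>(module_vec TYPE('a) n)\<lparr>carrier := W\<rparr>\<^esub> = 0\<^sub>v n"
    by (simp add: module_vec_simps)
  obtain B where B: "finite B" "W.basis B"
    using W.finite_basis_exists[OF vec_subspace_fin_dim[OF assms]] by blast
  show ?thesis
  proof
    assume "W.dim = 0"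
    then have "B = {}" using W.dim_basis[OF B] B(1) by simp
    then show "W = {0\<^sub>v n}" using B(2) unfolding W.basis_def by (simp add: W.span_empty[unfolded zero])
  next
    assume "W = {0\<^sub>v n}"
    then have "W.gen_set {}" using W.span_empty[unfolded zero] by simp
    then show "W.dim = 0" using W.gen_ge_dim[of "{}"] by simp
  qed
qed

text \<open>Rank-nullity with trivial kernel. Linearity is demanded only on \<open>W\<close>,
  elementwise. The lemma serves two maps: deletion of a coordinate in a code, and the encoding
  \<open>L * VS\<close> on a subspace \<open>U\<close>.\<close>

lemma injective_image_vec_subspace:
  fixes W :: "'a::{field,finite} vec set" and f :: "'a vec \<Rightarrow> 'a vec"
  assumes W: "vec_subspace n W"
    and car: "\<And>v. v \<in> W \<Longrightarrow> f v \<in> carrier_vec l"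
    and add: "\<And>v w. v \<in> W \<Longrightarrow> w \<in> W \<Longrightarrow> f (v + w) = f v + f w"
    and smult: "\<And>c v. v \<in> W \<Longrightarrow> f (c \<cdot>\<^sub>v v) = c \<cdot>\<^sub>v f v"
    and nz: "\<And>v. v \<in> W \<Longrightarrow> v \<noteq> 0\<^sub>v n \<Longrightarrow> f v \<noteq> 0\<^sub>v l"
  shows "vec_subspace l (f ` W)" and "vec_subspace_dim l (f ` W) = vec_subspace_dim n W"
proof -
  let ?V = "(module_vec TYPE('a) n)\<lparr>carrier := W\<rparr>" and ?U = "module_vec TYPE('a) l"
  have hom: "f \<in> LinearCombinations.module_hom class_ring ?V ?U"
    unfolding LinearCombinations.module_hom_def by (simp add: module_vec_simps car add smult)
  interpret W: vectorspace class_ring ?V by (rule vec_subspace_vectorspace[OF W])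
  interpret U: vectorspace class_ring ?U by (rule vec_vs)
  interpret linear_map class_ring ?V ?U f
    by unfold_locales (rule hom)
  have im: "imT = f ` W" by (simp add: im_def)
  have zero: "f (0\<^sub>v n) = 0\<^sub>v l" using T0_is_0 by (simp add: module_vec_simps)
  have "kerT = {0\<^sub>v n}"
  proof
    show "kerT \<subseteq> {0\<^sub>v n}" using nz by (auto simp: ker_def module_vec_simps)
    show "{0\<^sub>v n} \<subseteq> kerT" using zero W by (simp add: ker_def module_vec_simps vec_subspace_iff)
  qed
  then have inj: "inj_on f (carrier ?V)"
    by (intro Ke0_imp_inj) (simp add: module_vec_simps)
  show "vec_subspace l (f ` W)" using imT_is_subspace by (simp add: im)
  show "vec_subspace_dim l (f ` W) = vec_subspace_dim n W"
    using rank_nullity[OF vec_subspace_fin_dim[OF W]] inj_imp_dim_ker0[OF inj]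
    by (simp add: im)
qed

text \<open>Double annihilator: a functional that vanishes on the common kernel of \<open>F\<close>
  is a linear combination of \<open>F\<close>. The induction eliminates one functional at a time.
  Its contrapositive produces vectors in confusion sets.\<close>

lemma vec_subspace_mem_of_annihilator:
  fixes F W :: "'a::field vec set"
  assumes W: "vec_subspace n W" and F: "finite F" "F \<subseteq> W"
    and r: "r \<in> carrier_vec n"
    and ann: "\<And>Z. Z \<in> carrier_vec n \<Longrightarrow> (\<And>f. f \<in> F \<Longrightarrow> f \<bullet> Z = 0) \<Longrightarrow> r \<bullet> Z = 0"
  shows "r \<in> W"
  using F r ann
proof (induction F arbitrary: r rule: finite_induct)
  case empty
  \<comment> \<open>With \<open>F\<close> empty, \<open>r\<close> vanishes on every vector, and unit
    vectors read off its coordinates.\<close>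
  have "r $ i = 0" if "i < n" for i
    using empty(3)[of "unit_vec n i"] that empty(2) by simp
  then have "r = 0\<^sub>v n" using empty(2) by auto
  then show ?case using W by (auto simp: vec_subspace_iff)
next
  case (insert g F)
  have Wc: "W \<subseteq> carrier_vec n" using W by (auto simp: vec_subspace_iff)
  have FW: "F \<subseteq> W" and gW: "g \<in> W" using insert.prems(1) by auto
  have Fc: "f \<in> carrier_vec n" if "f \<in> F" for f using FW Wc that by auto
  have gc: "g \<in> carrier_vec n" using gW Wc by auto
  note rc = insert.prems(2)
  show ?case
  proof (cases "\<exists>Z\<in>carrier_vec n. (\<forall>f\<in>F. f \<bullet> Z = 0) \<and> g \<bullet> Z \<noteq> 0")
    case False
    then show ?thesis by (intro insert.IH[OF FW rc]) (auto intro!: insert.prems(3))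
  next
    case True
    then obtain Y where Y: "Y \<in> carrier_vec n" "\<And>f. f \<in> F \<Longrightarrow> f \<bullet> Y = 0" "g \<bullet> Y \<noteq> 0" by blast
    \<comment> \<open>\<open>c\<close> is the coefficient for which
      \<open>r - c \<cdot>\<^sub>v g\<close> vanishes at \<open>Y\<close>.\<close>
    define c where "c = (r \<bullet> Y) / (g \<bullet> Y)"
    have "r - c \<cdot>\<^sub>v g \<in> W"
    proof (rule insert.IH[OF FW])
      show "r - c \<cdot>\<^sub>v g \<in> carrier_vec n" using rc gc by simp
      fix Z assume Z: "Z \<in> carrier_vec n" "\<And>f. f \<in> F \<Longrightarrow> f \<bullet> Z = 0"
      \<comment> \<open>Projection along \<open>Y\<close>: this \<open>b\<close> makes
        \<open>g\<close> vanish at \<open>Z - b \<cdot>\<^sub>v Y\<close>, while \<open>F\<close>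
        still vanishes there, so the assumption on \<open>r\<close> applies to that vector.\<close>
      define b where "b = (g \<bullet> Z) / (g \<bullet> Y)"
      have dist: "h \<bullet> (Z - b \<cdot>\<^sub>v Y) = h \<bullet> Z - b * (h \<bullet> Y)" if "h \<in> carrier_vec n" for h
        using that Z(1) Y(1) scalar_prod_minus_distrib[of h n Z "b \<cdot>\<^sub>v Y"] by simp
      have "r \<bullet> (Z - b \<cdot>\<^sub>v Y) = 0"
      proof (rule insert.prems(3))
        show "Z - b \<cdot>\<^sub>v Y \<in> carrier_vec n" using Z Y by simp
        show "f \<bullet> (Z - b \<cdot>\<^sub>v Y) = 0" if "f \<in> insert g F" for f
          using that Z(2) Y(2,3) dist[of f] gc Fc by (auto simp: b_def)
      qed
      then have "r \<bullet> Z = b * (r \<bullet> Y)" by (simp add: dist rc)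
      then show "(r - c \<cdot>\<^sub>v g) \<bullet> Z = 0"
        using rc gc Z(1) minus_scalar_prod_distrib[of r n "c \<cdot>\<^sub>v g" Z] by (simp add: b_def c_def)
    qed
    moreover have "r = (r - c \<cdot>\<^sub>v g) + c \<cdot>\<^sub>v g" using rc gc by auto
    ultimately show ?thesis using W gW unfolding vec_subspace_iff by metis
  qed
qed

section \<open>Hamming weight and distance\<close>

lemma hamming_weight_le: "hamming_weight v \<le> dim_vec v"
proof -
  have "card {j. j < dim_vec v \<and> v $ j \<noteq> 0} \<le> card {..<dim_vec v}" by (rule card_mono) auto
  then show ?thesis by (simp add: hamming_weight_def)
qed

lemma hamming_weight_eq_0_iff:
  assumes "v \<in> carrier_vec n"
  shows "hamming_weight v = 0 \<longleftrightarrow> v = 0\<^sub>v n"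
proof -
  have "finite {j. j < dim_vec v \<and> v $ j \<noteq> 0}" by simp
  then have "hamming_weight v = 0 \<longleftrightarrow> (\<forall>j<dim_vec v. v $ j = 0)"
    by (auto simp: hamming_weight_def)
  also have "\<dots> \<longleftrightarrow> v = 0\<^sub>v n" using assms by (auto simp: vec_eq_iff)
  finally show ?thesis .
qed

lemma hamming_weight_minus_le:
  fixes u v :: "'a::group_add vec"
  assumes "u \<in> carrier_vec n" "v \<in> carrier_vec n"
  shows "hamming_weight (u - v) \<le> hamming_weight u + hamming_weight v"
proof -
  have "hamming_weight (u - v) \<le> card ({j. j < n \<and> u $ j \<noteq> 0} \<union> {j. j < n \<and> v $ j \<noteq> 0})"
    unfolding hamming_weight_def using assms by (intro card_mono) auto
  also have "\<dots> \<le> hamming_weight u + hamming_weight v"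
    using assms card_Un_le[of "{j. j < n \<and> u $ j \<noteq> 0}" "{j. j < n \<and> v $ j \<noteq> 0}"]
    by (simp add: hamming_weight_def)
  finally show ?thesis .
qed

lemma hamming_dist_conv_weight:
  fixes u v :: "'a::group_add vec"
  assumes "u \<in> carrier_vec n" "v \<in> carrier_vec n"
  shows "hamming_dist u v = hamming_weight (u - v)"
  unfolding hamming_dist_def hamming_weight_def using assms
  by (intro arg_cong[where f = card]) auto

text \<open>A support of size at most \<open>2 * \<delta>\<close> is cut into two pieces of size at
  most \<open>\<delta>\<close>: \<open>v\<close> copies \<open>y\<close> on one, \<open>u\<close>
  cancels it on the other. In the form \<open>y + u = v\<close>, the words \<open>y\<close> and 0
  become indistinguishable after the errors \<open>u\<close> and \<open>v\<close>.\<close>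

lemma hamming_weight_split:
  fixes y :: "'a::ring vec"
  assumes y: "y \<in> carrier_vec n" and le: "hamming_weight y \<le> 2 * \<delta>"
  obtains u v where "u \<in> carrier_vec n" "v \<in> carrier_vec n" "y + u = v"
    "hamming_weight u \<le> \<delta>" "hamming_weight v \<le> \<delta>"
proof -
  define S where "S = {j. j < n \<and> y $ j \<noteq> 0}"
  have S: "finite S" "card S \<le> 2 * \<delta>"
    using le y by (auto simp: S_def hamming_weight_def)
  \<comment> \<open>The minimum covers supports with fewer than \<open>\<delta>\<close> elements;
    then \<open>T\<close> is all of \<open>S\<close>.\<close>
  obtain T where T: "T \<subseteq> S" "card T = min \<delta> (card S)"
    using obtain_subset_with_card_n[of "min \<delta> (card S)" S] by auto
  define u where "u = vec n (\<lambda>j. if j \<in> T then 0 else - y $ j)"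
  define v where "v = vec n (\<lambda>j. if j \<in> T then y $ j else 0)"
  have "hamming_weight u = card (S - T)" "hamming_weight v = card T"
    unfolding hamming_weight_def u_def v_def using T(1)
    by (auto intro!: arg_cong[where f = card] simp: S_def split: if_splits)
  moreover have "card (S - T) = card S - card T"
    using S(1) T(1) by (intro card_Diff_subset) (auto intro: finite_subset)
  ultimately have "hamming_weight u \<le> \<delta>" "hamming_weight v \<le> \<delta>" using S(2) T(2) by auto
  moreover have "y + u = v" using y by (auto simp: u_def v_def)
  ultimately show ?thesis using that[of u v] by (simp add: u_def v_def)
qed

section \<open>Minimum distance of linear codes\<close>

text \<open>Differences of codewords are codewords, so the distances between distinct words are
  exactly the weights of nonzero words. A nonzero word makes the set under \<open>Min\<close>
  nonempty.\<close>

lemma min_dist_vec_subspace: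
  fixes C :: "'a::{field,finite} vec set"
  assumes C: "vec_subspace l C" and nz: "C \<noteq> {0\<^sub>v l}"
  shows "\<exists>v\<in>C. v \<noteq> 0\<^sub>v l \<and> hamming_weight v = min_dist C"
    and "\<And>v. v \<in> C \<Longrightarrow> v \<noteq> 0\<^sub>v l \<Longrightarrow> min_dist C \<le> hamming_weight v"
proof -
  have Cc: "C \<subseteq> carrier_vec l" and z: "0\<^sub>v l \<in> C" using C by (auto simp: vec_subspace_iff)
  have diff: "u - v \<in> C" if "u \<in> C" "v \<in> C" for u v
  proof -
    have "u + (- 1) \<cdot>\<^sub>v v \<in> C" using C that by (auto simp: vec_subspace_iff)
    moreover have "u + (- 1) \<cdot>\<^sub>v v = u - v" using that Cc by auto
    ultimately show ?thesis by simp
  qed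
  let ?D = "{hamming_dist x y |x y. x \<in> C \<and> y \<in> C \<and> x \<noteq> y}"
  let ?W = "hamming_weight ` (C - {0\<^sub>v l})"
  have "?D = ?W"
  proof (intro equalityI subsetI)
    fix d assume "d \<in> ?D"
    then obtain x y where xy: "d = hamming_dist x y" "x \<in> C" "y \<in> C" "x \<noteq> y" by blast
    then have "d = hamming_weight (x - y)" using hamming_dist_conv_weight[of x l y] Cc by auto
    moreover have "x - y \<noteq> 0\<^sub>v l"
    proof
      assume eq: "x - y = 0\<^sub>v l"
      have c: "x \<in> carrier_vec l" "y \<in> carrier_vec l" using xy(2,3) Cc by auto
      then have "x = (x - y) + y" by auto
      also have "\<dots> = y" unfolding eq using c by simp
      finally show False using xy by simp
    qed
    ultimately show "d \<in> ?W" using diff[OF xy(2,3)] by blast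
  next
    fix d assume "d \<in> ?W"
    then obtain v where v: "v \<in> C" "v \<noteq> 0\<^sub>v l" "d = hamming_weight v" by blast
    have "v - 0\<^sub>v l = v" using v Cc by auto
    then have "d = hamming_dist v (0\<^sub>v l)"
      using v Cc hamming_dist_conv_weight[of v l "0\<^sub>v l"] by auto
    then show "d \<in> ?D" using v z by blast
  qed
  then have md: "min_dist C = Min ?W" by (simp add: min_dist_def)
  have fin: "finite ?W" using finite_subset[OF Cc finite_carrier_vec] by simp
  have "?W \<noteq> {}" using nz z by blast
  then have "Min ?W \<in> ?W" by (rule Min_in[OF fin])
  then show "\<exists>v\<in>C. v \<noteq> 0\<^sub>v l \<and> hamming_weight v = min_dist C" unfolding md by force
  show "min_dist C \<le> hamming_weight v" if "v \<in> C" "v \<noteq> 0\<^sub>v l" for v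
    unfolding md using fin that by (intro Min_le) auto
qed

text \<open>
  The definition of \<open>N(k, d)\<close> asks for minimum distance exactly \<open>d\<close>. Zeroing a coordinate
  in the support of a word of minimum weight lowers the minimum distance by exactly one and
  keeps the length.
\<close>

lemma decrease_min_dist:
  fixes C :: "'a::{field,finite} vec set"
  assumes "vec_subspace l C" and "C \<noteq> {0\<^sub>v l}" and "0 < d"
    and "\<And>v. v \<in> C \<Longrightarrow> v \<noteq> 0\<^sub>v l \<Longrightarrow> d \<le> hamming_weight v"
  shows "\<exists>C' :: 'a vec set. vec_subspace l C' \<and> vec_subspace_dim l C' = vec_subspace_dim l C
           \<and> min_dist C' = d"
  using assms
proof (induction "min_dist C" arbitrary: C rule: less_induct)
  case less
  have Cc: "C \<subseteq> carrier_vec l" using less.prems(1) by (auto simp: vec_subspace_iff)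
  obtain v where v: "v \<in> C" "v \<noteq> 0\<^sub>v l" "hamming_weight v = min_dist C"
    using min_dist_vec_subspace(1)[OF less.prems(1,2)] by blast
  have le: "d \<le> min_dist C" using less.prems(4)[OF v(1,2)] v(3) by simp
  show ?case
  proof (cases "min_dist C = d")
    case True
    then show ?thesis using less.prems(1) by blast
  next
    case False
    then have lt: "d < min_dist C" using le by simp
    obtain j where j: "j < l" "v $ j \<noteq> 0" using v Cc by (auto simp: vec_eq_iff)
    define f :: "'a vec \<Rightarrow> 'a vec" where "f u = vec l (\<lambda>i. if i = j then 0 else u $ i)" for u
    have wt: "hamming_weight (f u) = card ({i. i < l \<and> u $ i \<noteq> 0} - {j})" for u
      unfolding hamming_weight_def f_def by (auto intro!: arg_cong[where f = card] split: if_splits)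
    have wt_C: "hamming_weight u = card {i. i < l \<and> u $ i \<noteq> 0}" if "u \<in> C" for u
      using that Cc by (auto simp: hamming_weight_def)
    have ge: "min_dist C - 1 \<le> hamming_weight (f u)" if u: "u \<in> C" "u \<noteq> 0\<^sub>v l" for u
    proof -
      have "card {i. i < l \<and> u $ i \<noteq> 0} - card {j} \<le> card ({i. i < l \<and> u $ i \<noteq> 0} - {j})"
        by (rule diff_card_le_card_Diff) simp
      then show ?thesis using min_dist_vec_subspace(2)[OF less.prems(1,2) u] wt wt_C[OF u(1)]
        by simp
    qed
    \<comment> \<open>Since \<open>d < min_dist C\<close> and \<open>0 < d\<close>, every nonzero
      word keeps a positive weight. So \<open>f\<close> is injective on \<open>C\<close> and
      preserves the dimension.\<close>
    have nz: "f u \<noteq> 0\<^sub>v l" if "u \<in> C" "u \<noteq> 0\<^sub>v l" for u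
      using ge[OF that] lt less.prems(3) hamming_weight_eq_0_iff[of "f u" l]
      by (auto simp: f_def)
    have f_add: "f (u + w) = f u + f w" if "u \<in> C" "w \<in> C" for u w
      using subsetD[OF Cc that(1)] subsetD[OF Cc that(2)] by (auto simp: f_def)
    have f_smult: "f (c \<cdot>\<^sub>v u) = c \<cdot>\<^sub>v f u" if "u \<in> C" for c u
      using subsetD[OF Cc that] by (auto simp: f_def)
    have f_carrier: "f u \<in> carrier_vec l" for u by (simp add: f_def)
    note sub = injective_image_vec_subspace(1)[OF less.prems(1) f_carrier f_add f_smult nz]
      and dim = injective_image_vec_subspace(2)[OF less.prems(1) f_carrier f_add f_smult nz]
    have nz_im: "f ` C \<noteq> {0\<^sub>v l}" using nz[OF v(1,2)] v(1) by blast
    \<comment> \<open>The minimum-weight word \<open>v\<close> loses its nonzero entry at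
      \<open>j\<close>, so the induction measure drops strictly.\<close>
    have fv: "hamming_weight (f v) < min_dist C"
      using j v(3) lt wt[of v] wt_C[OF v(1)] by simp
    have "min_dist (f ` C) < min_dist C"
      using min_dist_vec_subspace(2)[OF sub nz_im, of "f v"] nz[OF v(1,2)] v(1) fv by auto
    moreover have "d \<le> hamming_weight w" if "w \<in> f ` C" "w \<noteq> 0\<^sub>v l" for w
    proof -
      obtain u where u: "u \<in> C" "w = f u" using \<open>w \<in> f ` C\<close> by blast
      have "f (0\<^sub>v l) = 0\<^sub>v l" by (auto simp: f_def)
      then have "u \<noteq> 0\<^sub>v l" using u that(2) by auto
      then show ?thesis using ge[OF u(1)] u(2) lt by simp
    qed
    ultimately show ?thesis using less.hyps[OF _ sub nz_im less.prems(3)] dim by simp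
  qed
qed

section \<open>Weight criterion for error-correcting index codes\<close>

text \<open>Decoding fails at receiver \<open>i\<close> exactly if two messages with equal side
  information but different demands can arrive as the same word. By linearity only their difference
  \<open>Z\<close> matters, and the differences of two errors of weight at most
  \<open>\<delta>\<close> are exactly the vectors of weight at most
  \<open>2 * \<delta>\<close>.\<close>

lemma represents_ecic_iff:
  fixes VS R L :: "'a::{field,finite} mat"
  assumes VS: "VS \<in> carrier_mat k n" and V: "\<And>i. i < m \<Longrightarrow> V i \<in> carrier_mat (d i) n"
    and R: "R \<in> carrier_mat m n"
  shows "represents_ecic m n VS V R \<delta> N L \<longleftrightarrow>
    0 < N \<and> L \<in> carrier_mat N k \<and>
    (\<forall>i<m. \<forall>Z\<in>confusion_set n (V i) (row R i). 2 * \<delta> < hamming_weight (L *\<^sub>v (VS *\<^sub>v Z)))"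
proof -
  have "(\<exists>D :: 'a vec \<Rightarrow> 'a vec \<Rightarrow> 'a. \<forall>X\<in>carrier_vec n. \<forall>W\<in>carrier_vec N.
            hamming_weight W \<le> \<delta> \<longrightarrow> D (L *\<^sub>v (VS *\<^sub>v X) + W) (V i *\<^sub>v X) = row R i \<bullet> X) \<longleftrightarrow>
        (\<forall>Z\<in>confusion_set n (V i) (row R i). 2 * \<delta> < hamming_weight (L *\<^sub>v (VS *\<^sub>v Z)))"
    (is "(\<exists>D. ?dec D) \<longleftrightarrow> ?sep")
    if L: "L \<in> carrier_mat N k" and i: "i < m" for i
  proof
    have Vi: "V i \<in> carrier_mat (d i) n" by (rule V[OF i])
    have r: "row R i \<in> carrier_vec n" using R i by auto
    let ?g = "\<lambda>X. L *\<^sub>v (VS *\<^sub>v X)"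
    have gc: "?g X \<in> carrier_vec N" if "X \<in> carrier_vec n" for X
      using L VS that by (auto intro!: mult_mat_vec_carrier)
    {
      assume "\<exists>D. ?dec D"
      then obtain D where D: "\<And>X W. X \<in> carrier_vec n \<Longrightarrow> W \<in> carrier_vec N \<Longrightarrow>
          hamming_weight W \<le> \<delta> \<Longrightarrow> D (?g X + W) (V i *\<^sub>v X) = row R i \<bullet> X" by blast
      show ?sep
      proof (intro ballI, rule ccontr)
        fix Z assume "Z \<in> confusion_set n (V i) (row R i)"
        then have Z: "Z \<in> carrier_vec n" "V i *\<^sub>v Z = 0\<^sub>v (d i)" "row R i \<bullet> Z \<noteq> 0"
          using Vi by (auto simp: confusion_set_def)
        assume "\<not> 2 * \<delta> < hamming_weight (?g Z)"
        \<comment> \<open>The message \<open>Z\<close> with error \<open>u\<close> and the message 0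
          with error \<open>v\<close> both arrive as \<open>v\<close> with side information 0, so
          \<open>D\<close> would have to return both a nonzero value and 0.\<close>
        then obtain u v where uv: "u \<in> carrier_vec N" "v \<in> carrier_vec N" "?g Z + u = v"
          "hamming_weight u \<le> \<delta>" "hamming_weight v \<le> \<delta>"
          using hamming_weight_split[OF gc[OF Z(1)], of \<delta>] by (metis not_less)
        have "VS *\<^sub>v 0\<^sub>v n = 0\<^sub>v k" using VS by auto
        then have zero: "?g (0\<^sub>v n) = 0\<^sub>v N" "V i *\<^sub>v 0\<^sub>v n = 0\<^sub>v (d i)"
          using L VS Vi by auto
        have "row R i \<bullet> Z = D v (0\<^sub>v (d i))" using D[OF Z(1) uv(1,4)] uv(3) Z(2) by simp
        also have "\<dots> = row R i \<bullet> 0\<^sub>v n"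
          using D[of "0\<^sub>v n" v] uv(2,5) zero by simp
        also have "\<dots> = 0" using r by simp
        finally show False using Z(3) by simp
      qed
    }
    assume sep: ?sep
    \<comment> \<open>\<open>P y a X\<close> says that message \<open>X\<close> is consistent with
      the received word \<open>y\<close> and the side information \<open>a\<close>.\<close>
    define P where "P y a X \<longleftrightarrow> X \<in> carrier_vec n \<and> V i *\<^sub>v X = a \<and>
      (\<exists>W\<in>carrier_vec N. hamming_weight W \<le> \<delta> \<and> y = ?g X + W)" for y a X
    have unique: "row R i \<bullet> X = row R i \<bullet> Y" if PX: "P y a X" and PY: "P y a Y" for y a X Y
    proof (rule ccontr)
      assume ne: "row R i \<bullet> X \<noteq> row R i \<bullet> Y"
      have c: "X \<in> carrier_vec n" "Y \<in> carrier_vec n" using PX PY by (auto simp: P_def)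
      obtain W W' where W: "W \<in> carrier_vec N" "W' \<in> carrier_vec N" "hamming_weight W \<le> \<delta>"
        "hamming_weight W' \<le> \<delta>" "?g X + W = ?g Y + W'" using PX PY by (auto simp: P_def)
      have "V i *\<^sub>v (X - Y) = V i *\<^sub>v X - V i *\<^sub>v Y" by (rule mult_minus_distrib_mat_vec[OF Vi c])
      then have "V i *\<^sub>v (X - Y) = 0\<^sub>v (d i)" using PX PY Vi by (auto simp: P_def)
      moreover have "row R i \<bullet> (X - Y) \<noteq> 0"
        using ne scalar_prod_minus_distrib[OF r c] by simp
      ultimately have "X - Y \<in> confusion_set n (V i) (row R i)"
        using c Vi by (auto simp: confusion_set_def)
      then have "2 * \<delta> < hamming_weight (?g (X - Y))" using sep by blast
      also have "?g (X - Y) = ?g X - ?g Y"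
        using mult_minus_distrib_mat_vec[OF VS c] VS c
          mult_minus_distrib_mat_vec[OF L, of "VS *\<^sub>v X" "VS *\<^sub>v Y"]
        by simp
      also have "\<dots> = W' - W"
      proof
        show "dim_vec (?g X - ?g Y) = dim_vec (W' - W)" using L W by auto
        fix j assume "j < dim_vec (W' - W)"
        then have "j < N" using W by auto
        then have "?g X $ j + W $ j = ?g Y $ j + W' $ j"
          using arg_cong[OF W(5), of "\<lambda>y. y $ j"] L W(1,2) by simp
        then show "(?g X - ?g Y) $ j = (W' - W) $ j"
          using \<open>j < N\<close> L W(1,2) by (simp add: algebra_simps)
      qed
      also have "hamming_weight \<dots> \<le> 2 * \<delta>"
        using hamming_weight_minus_le[OF W(2,1)] W(3,4) by simp
      finally show False by simp
    qed
    show "\<exists>D. ?dec D"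
    proof (rule exI)
      \<comment> \<open>The decoder picks any consistent message; by \<open>unique\<close> the
        demand does not depend on the choice. On pairs with no consistent message its value is
        arbitrary.\<close>
      show "?dec (\<lambda>y a. row R i \<bullet> (SOME X. P y a X))"
      proof (intro ballI impI)
        fix X W :: "'a vec"
        assume "X \<in> carrier_vec n" "W \<in> carrier_vec N" "hamming_weight W \<le> \<delta>"
        then have P: "P (?g X + W) (V i *\<^sub>v X) X" by (auto simp: P_def)
        then show "row R i \<bullet> (SOME Y. P (?g X + W) (V i *\<^sub>v X) Y) = row R i \<bullet> X"
          using unique someI by metis
      qed
    qed
  qed
  then show ?thesis using VS unfolding represents_ecic_def by auto
qed

section \<open>Generator matrices, confusion sets and existence of an ECIC\<close>

lemma mat_mult_vec_eq_0_iff: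
  assumes "A \<in> carrier_mat k n"
  shows "A *\<^sub>v Z = 0\<^sub>v k \<longleftrightarrow> (\<forall>f\<in>set (rows A). f \<bullet> Z = 0)"
proof -
  have "set (rows A) = row A ` {..<k}" using assms by (auto simp: rows_def)
  then show ?thesis using assms by (auto simp: vec_eq_iff)
qed

text \<open>As \<open>r\<close> lies outside the row space of \<open>V\<close>, it cannot vanish on
  the whole kernel of \<open>V\<close>. This keeps \<alpha> positive, away from the zero code, which
  has no minimum distance.\<close>

lemma confusion_set_nonempty:
  fixes V :: "'a::field mat"
  assumes W: "vec_subspace n W" and gen: "generator_matrix n W V"
    and r: "r \<in> carrier_vec n" "r \<notin> W"
  shows "confusion_set n V r \<noteq> {}"
proof -
  interpret vec_space "TYPE('a)" n .
  obtain k where V: "V \<in> carrier_mat k n" and W_eq: "row_space V = W"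
    using gen by (auto simp: generator_matrix_def)
  have "set (rows V) \<subseteq> carrier_vec n" using V by (auto simp: rows_def)
  then have "set (rows V) \<subseteq> W" using in_own_span[of "set (rows V)"] W_eq by (simp add: row_space_def)
  then obtain Z where "Z \<in> carrier_vec n" "\<And>f. f \<in> set (rows V) \<Longrightarrow> f \<bullet> Z = 0" "r \<bullet> Z \<noteq> 0"
    using vec_subspace_mem_of_annihilator[OF W, of "set (rows V)" r] r by auto
  then have "Z \<in> confusion_set n V r"
    using V mat_mult_vec_eq_0_iff[OF V, of Z] by (auto simp: confusion_set_def)
  then show ?thesis by blast
qed

text \<open>Writing \<open>r\<close> as a combination \<open>y\<close> of the rows of
  \<open>VS\<close> gives \<open>r \<bullet> Z = y \<bullet> (VS *\<^sub>v Z)\<close>, so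
  \<open>VS\<close> cannot kill \<open>Z\<close>.\<close>

lemma generator_mult_vec_neq_0:
  fixes VS :: "'a::field mat"
  assumes VS: "VS \<in> carrier_mat k n" and gen: "generator_matrix n W VS"
    and r: "r \<in> W" and Z: "Z \<in> carrier_vec n" "r \<bullet> Z \<noteq> 0"
  shows "VS *\<^sub>v Z \<noteq> 0\<^sub>v k"
proof
  interpret vec_space "TYPE('a)" n .
  assume zero: "VS *\<^sub>v Z = 0\<^sub>v k"
  obtain y where y: "y \<in> carrier_vec k" "r = VS\<^sup>T *\<^sub>v y"
  proof -
    have "r \<in> row_space VS" using r gen by (simp add: generator_matrix_def)
    then show ?thesis using that VS unfolding row_space_eq[OF VS] by blast
  qed
  have "r \<bullet> Z = y \<bullet> (VS *\<^sub>v Z)"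
    unfolding y(2) by (rule transpose_vec_mult_scalar[OF VS Z(1) y(1)])
  then show False using zero Z(2) y(1) by simp
qed

text \<open>Guarantees that the \<open>LEAST\<close> in \<open>min_ecic_length\<close> is attained
  by an actual code.\<close>

lemma ex_represents_ecic:
  fixes VS R :: "'a::{field,finite} mat"
  assumes VS: "VS \<in> carrier_mat k n" and V: "\<And>i. i < m \<Longrightarrow> V i \<in> carrier_mat (d i) n"
    and R: "R \<in> carrier_mat m n"
    and sep: "\<And>i Z. i < m \<Longrightarrow> Z \<in> confusion_set n (V i) (row R i) \<Longrightarrow> VS *\<^sub>v Z \<noteq> 0\<^sub>v k"
  shows "\<exists>N L. represents_ecic m n VS V R \<delta> N L"
proof -
  \<comment> \<open>The \<open>q\<close>-fold repetition code, with one extra zero row so that the length is positive.\<close>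
  define q where "q = 2 * \<delta> + 1"
  define L :: "'a mat" where "L = mat (Suc (k * q)) k (\<lambda>(a, b). if a div q = b then 1 else 0)"
  have q: "0 < q" by (simp add: q_def)
  have L: "L \<in> carrier_mat (Suc (k * q)) k" by (simp add: L_def)
  have "2 * \<delta> < hamming_weight (L *\<^sub>v y)" if y: "y \<in> carrier_vec k" "y \<noteq> 0\<^sub>v k" for y
  proof -
    obtain b where b: "b < k" "y $ b \<noteq> 0" using y by (auto simp: vec_eq_iff)
    \<comment> \<open>The \<open>q\<close> positions in this block all repeat coordinate
      \<open>b\<close>, so one nonzero coordinate of \<open>y\<close> already yields weight at least
      \<open>2 * \<delta> + 1\<close>.\<close>
    have "(L *\<^sub>v y) $ a = y $ b" "a < Suc (k * q)" if "a \<in> {b * q..<b * q + q}" for a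
    proof -
      have "a div q = b" using that by (intro div_nat_eqI) (auto simp: mult.commute)
      moreover have "Suc b * q \<le> k * q" using b(1) by (intro mult_le_mono1) simp
      then show "a < Suc (k * q)" using that by simp
      ultimately show "(L *\<^sub>v y) $ a = y $ b"
        using y(1) b(1) by (simp add: L_def scalar_prod_def if_distrib if_distribR cong: if_cong)
    qed
    then have "card {b * q..<b * q + q} \<le> hamming_weight (L *\<^sub>v y)"
      unfolding hamming_weight_def using L b(2) by (intro card_mono) auto
    then show ?thesis by (simp add: q_def)
  qed
  moreover have "VS *\<^sub>v Z \<in> carrier_vec k" if "Z \<in> confusion_set n (V i) (row R i)" for i Z
    using that VS by (auto simp: confusion_set_def)
  ultimately have "represents_ecic m n VS V R \<delta> (Suc (k * q)) L"
    using represents_ecic_iff[where V = V, OF VS V R] L sep by auto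
  then show ?thesis by blast
qed

section \<open>Attainment of \<alpha> by a nonzero subspace\<close>

lemma line_vec_subspace:
  fixes Z :: "'a::field vec"
  assumes "Z \<in> carrier_vec n"
  shows "vec_subspace n (range (\<lambda>c. c \<cdot>\<^sub>v Z))"
proof -
  have "0\<^sub>v n = 0 \<cdot>\<^sub>v Z" using assms by auto
  moreover have "a \<cdot>\<^sub>v Z + b \<cdot>\<^sub>v Z = (a + b) \<cdot>\<^sub>v Z" for a b by (simp add: add_smult_distrib_vec)
  moreover have "a \<cdot>\<^sub>v (b \<cdot>\<^sub>v Z) = (a * b) \<cdot>\<^sub>v Z" for a b by (simp add: smult_smult_assoc)
  ultimately show ?thesis using assms unfolding vec_subspace_iff by auto
qed

lemma smult_mem_confusion_set:
  fixes V :: "'a::field mat"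
  assumes V: "V \<in> carrier_mat k n" and r: "r \<in> carrier_vec n"
    and Z: "Z \<in> confusion_set n V r" and c: "c \<noteq> 0"
  shows "c \<cdot>\<^sub>v Z \<in> confusion_set n V r"
  using assms mult_mat_vec[OF V, of Z c] by (auto simp: confusion_set_def)

text \<open>Finitely many subspaces compete, so the maximum is attained. The line through
  \<open>Z\<close> competes because confusion sets are closed under nonzero scaling, and its
  positive dimension forces the maximiser to be nonzero.\<close>

lemma iccsi_alpha_attained:
  fixes V :: "nat \<Rightarrow> 'a::{field,finite} mat"
  assumes V: "\<And>i. i < m \<Longrightarrow> V i \<in> carrier_mat (d i) n"
    and R: "R \<in> carrier_mat m n"
    and Z: "i < m" "Z \<in> confusion_set n (V i) (row R i)"
  obtains U where "vec_subspace n U" "U \<noteq> {0\<^sub>v n}"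
    "U - {0\<^sub>v n} \<subseteq> (\<Union>i<m. confusion_set n (V i) (row R i))"
    "vec_subspace_dim n U = iccsi_alpha m n V R"
proof -
  let ?Q = "\<lambda>U. vec_subspace n U \<and> U - {0\<^sub>v n} \<subseteq> (\<Union>i<m. confusion_set n (V i) (row R i))"
  let ?S = "{vec_subspace_dim n U |U. ?Q U}"
  have alpha: "iccsi_alpha m n V R = Max ?S" by (simp add: iccsi_alpha_def)
  have "?S \<subseteq> vec_subspace_dim n ` Pow (carrier_vec n :: 'a vec set)"
    by (auto simp: vec_subspace_iff)
  then have fin: "finite ?S"
    by (rule finite_subset) (simp add: finite_carrier_vec)
  have Zc: "Z \<in> carrier_vec n" and rZ: "row R i \<bullet> Z \<noteq> 0" using Z by (auto simp: confusion_set_def)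
  have r: "row R i \<in> carrier_vec n" using R Z(1) by auto
  let ?l = "range (\<lambda>c. c \<cdot>\<^sub>v Z)"
  have l: "vec_subspace n ?l" by (rule line_vec_subspace[OF Zc])
  have zero: "0 \<cdot>\<^sub>v Z = 0\<^sub>v n" using Zc by auto
  have "c \<cdot>\<^sub>v Z \<in> confusion_set n (V i) (row R i)" if "c \<cdot>\<^sub>v Z \<noteq> 0\<^sub>v n" for c
    using that zero smult_mem_confusion_set[OF V[OF Z(1)] r Z(2), of c] by (cases "c = 0") auto
  then have "?l - {0\<^sub>v n} \<subseteq> (\<Union>i<m. confusion_set n (V i) (row R i))" using Z(1) by auto
  with l have Q: "?Q ?l" by (rule conjI)
  have "Z \<in> ?l" by (intro range_eqI[of _ _ 1]) simp
  moreover have "Z \<noteq> 0\<^sub>v n" using rZ r by auto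
  ultimately have "?l \<noteq> {0\<^sub>v n}" by blast
  then have pos: "0 < vec_subspace_dim n ?l" using vec_subspace_dim_eq_0_iff[OF l] by blast
  have mem: "vec_subspace_dim n ?l \<in> ?S" using Q by blast
  have "Max ?S \<in> ?S" using fin mem by (intro Max_in) auto
  then obtain U where U: "?Q U" "vec_subspace_dim n U = Max ?S" by fastforce
  have "vec_subspace_dim n ?l \<le> Max ?S" using fin mem by (rule Max_ge)
  then have "vec_subspace_dim n U \<noteq> 0" using pos U(2) by linarith
  then have "U \<noteq> {0\<^sub>v n}" using vec_subspace_dim_eq_0_iff[OF conjunct1[OF U(1)]] by simp
  then show ?thesis using that[of U] U alpha by auto
qed

section \<open>From an optimal ECIC to a linear code\<close>

theorem mainTheorem7:
  fixes m n \<delta> :: nat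
    and X :: "nat \<Rightarrow> 'a::{field,finite} vec set" and XS :: "'a vec set"
    and R VS :: "'a mat" and V :: "nat \<Rightarrow> 'a mat"
  assumes "iccsi_instance m n X XS R"
    and "generator_matrix n XS VS"
    and "\<And>i. i < m \<Longrightarrow> generator_matrix n (X i) (V i)"
  shows "min_code_length TYPE('a) (iccsi_alpha m n V R) (2 * \<delta> + 1)
           \<le> min_ecic_length m n VS V R \<delta>"
proof -
  let ?conf = "\<lambda>i. confusion_set n (V i) (row R i)"
  note inst = assms(1)[unfolded iccsi_instance_def]
  have R: "R \<in> carrier_mat m n" using inst by simp
  obtain k where VS: "VS \<in> carrier_mat k n" using assms(2) by (auto simp: generator_matrix_def)
  have V: "V i \<in> carrier_mat (vec_subspace_dim n (X i)) n" if "i < m" for i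
    using assms(3)[OF that] by (simp add: generator_matrix_def)
  have conf: "VS *\<^sub>v Z \<noteq> 0\<^sub>v k" if "i < m" "Z \<in> ?conf i" for i Z
    using generator_mult_vec_neq_0[OF VS assms(2), of "row R i" Z] inst that
    by (auto simp: confusion_set_def)
  define N where "N = min_ecic_length m n VS V R \<delta>"
  \<comment> \<open>\<open>conf\<close> says that \<open>VS\<close> kills no vector of a confusion
    set, which is what the repetition code requires.\<close>
  have "\<exists>L. represents_ecic m n VS V R \<delta> N L"
    unfolding N_def min_ecic_length_def
    by (rule LeastI_ex) (rule ex_represents_ecic[where V = V, OF VS V R conf])
  then obtain L where L: "L \<in> carrier_mat N k"
    and weight: "\<And>i Z. i < m \<Longrightarrow> Z \<in> ?conf i \<Longrightarrow> 2 * \<delta> < hamming_weight (L *\<^sub>v (VS *\<^sub>v Z))"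
    using represents_ecic_iff[where V = V, OF VS V R] by blast
  \<comment> \<open>Receiver 0 exists and supplies the confusion vector that makes \<alpha>
    positive.\<close>
  have m: "0 < m" using inst by simp
  then have "?conf 0 \<noteq> {}"
    using inst R by (intro confusion_set_nonempty[OF _ assms(3)[OF m]]) auto
  then obtain Z where Z: "Z \<in> ?conf 0" by blast
  obtain U where U: "vec_subspace n U" "U \<noteq> {0\<^sub>v n}" "U - {0\<^sub>v n} \<subseteq> (\<Union>i<m. ?conf i)"
    "vec_subspace_dim n U = iccsi_alpha m n V R"
    by (rule iccsi_alpha_attained[where V = V, OF V R m Z])
  have Uc: "U \<subseteq> carrier_vec n" and U0: "0\<^sub>v n \<in> U" using U(1) by (auto simp: vec_subspace_iff)
  define f where "f u = (L * VS) *\<^sub>v u" for u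
  have LVS: "L * VS \<in> carrier_mat N n" using L VS by simp
  have f_weight: "2 * \<delta> + 1 \<le> hamming_weight (f u)" if u: "u \<in> U" "u \<noteq> 0\<^sub>v n" for u
  proof -
    obtain i where i: "i < m" "u \<in> ?conf i" using U(3) u by blast
    have "f u = L *\<^sub>v (VS *\<^sub>v u)"
      unfolding f_def using assoc_mult_mat_vec[OF L VS, of u] u(1) Uc by auto
    then show ?thesis using weight[OF i] by simp
  qed
  have f_nz: "f u \<noteq> 0\<^sub>v N" if "u \<in> U" "u \<noteq> 0\<^sub>v n" for u
    using f_weight[OF that] hamming_weight_eq_0_iff[of "f u" N] LVS by (auto simp: f_def)
  have f_add: "f (u + v) = f u + f v" if "u \<in> U" "v \<in> U" for u v
    unfolding f_def using that Uc by (intro mult_add_distrib_mat_vec[OF LVS]) auto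
  have f_smult: "f (c \<cdot>\<^sub>v u) = c \<cdot>\<^sub>v f u" if "u \<in> U" for c u
    unfolding f_def using that Uc by (intro mult_mat_vec[OF LVS]) auto
  have f_carrier: "f u \<in> carrier_vec N" if "u \<in> U" for u
    using that Uc LVS by (auto simp: f_def)
  note im = injective_image_vec_subspace[OF U(1) f_carrier f_add f_smult f_nz]
  have im_nz: "f ` U \<noteq> {0\<^sub>v N}"
    using U(2) U0 f_nz by blast
  have "M *\<^sub>v 0\<^sub>v n = 0\<^sub>v N" if "M \<in> carrier_mat N n" for M :: "'a mat" using that by auto
  then have "f (0\<^sub>v n) = 0\<^sub>v N" using LVS by (simp add: f_def)
  then have "2 * \<delta> + 1 \<le> hamming_weight v" if "v \<in> f ` U" "v \<noteq> 0\<^sub>v N" for v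
    using that f_weight by auto
  \<comment> \<open>The image code may have a larger minimum distance, whereas
    \<open>min_code_length\<close> asks for exactly \<open>2 * \<delta> + 1\<close>; it is lowered
    at the same length \<open>N\<close> and dimension.\<close>
  then have "\<exists>C :: 'a vec set. vec_subspace N C \<and> vec_subspace_dim N C = iccsi_alpha m n V R
      \<and> min_dist C = 2 * \<delta> + 1"
    using decrease_min_dist[OF im(1) im_nz, of "2 * \<delta> + 1"] im(2) U(4) by simp
  then show ?thesis
    unfolding min_code_length_def N_def[symmetric] by (rule Least_le)
qed

end
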